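(* The set $$A := \{(1, 1), (1, 2), (1, 3), (2, 1), (2, 3), (2, 4), (3, 2), (3, 3), (3,4), (4, 1), (4, 2), (4, 4)\} \subset [4]^2$$ is line-free, one has $c^\mu_{2,4}=7$, and $$\sum_{\vec a \in \Delta_{2,4}} \frac{|A \cap \Gamma_{\vec a}|}{|\Gamma_{\vec a}|} > c^\mu_{2,4}.$$ Consequently, the statement "for every line-free subset $A$ of $[k]^n$ one has $\sum_{\vec a \in \Delta_{n,k}} |A \cap \Gamma_{\vec a}|/|\Gamma_{\vec a}| \le c^\mu_{n,k}$" is false for $k=4$, $n=2$.
   Context: $[k]^n$ is the set of words of length $n$ over $[k]=\{1,\dots,k\}$. A combinatorial line in $[k]^n$ is a set $\{w(i): i=1,\dots,k\}$, where $w \in ([k]\cup\{x\})^n$ is a word containing the wildcard $x$ at least once and $w(i)$ is obtained by replacing every $x$ by $i$; a set is line-free if it contains no combinatorial line. $\Delta_{n,k}$ is the set of all tuples $(a_1,\dots,a_k)$ of non-negative integers summing to $n$. For $\vec a=(a_1,\dots,a_k)\in\Delta_{n,k}$, the cell $\Gamma_{\vec a}\subset[k]^n$ is the set of words containing exactly $a_i$ letters equal to $i$ for each $i=1,\dots,k$. A simplex in $\Delta_{n,k}$ is a set of $k$ points of the form $(a_1+r,a_2,\dots,a_k), (a_1,a_2+r,\dots,a_k),\dots,(a_1,a_2,\dots,a_k+r)$ for some $0<r\le n$ and non-negative integers $a_1,\dots,a_k$ summing to $n-r$. A Fujimura set is a subset of $\Delta_{n,k}$ containing no simplex, and $c^\mu_{n,k}$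 is the maximal size of a Fujimura set in $\Delta_{n,k}$. *)

theory Defs
  imports Complex_Main
begin

(* [k]^n *)
definition words :: "nat \<Rightarrow> nat \<Rightarrow> nat list set" where
  "words n k = {w. length w = n \<and> set w \<subseteq> {1..k}}"

(* None is the wildcard x; it has to occur at least once *)
definition line_templates :: "nat \<Rightarrow> nat \<Rightarrow> nat option list set" where
  "line_templates n k =
     {w. length w = n \<and> set w \<subseteq> insert None (Some ` {1..k}) \<and> None \<in> set w}"

definition subst_wild :: "nat option list \<Rightarrow> nat \<Rightarrow> nat list" where
  "subst_wild w i = map (\<lambda>c. case c of None \<Rightarrow> i | Some j \<Rightarrow> j) w"

definition combinatorial_lines :: "nat \<Rightarrow> nat \<Rightarrow> nat list set set" where
  "combinatorial_lines n k = {subst_wild w ` {1..k} |w. w \<in> line_templates n k}"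

definition line_free :: "nat \<Rightarrow> nat \<Rightarrow> nat list set \<Rightarrow> bool" where
  "line_free n k A \<longleftrightarrow> (\<forall>L \<in> combinatorial_lines n k. \<not> L \<subseteq> A)"

definition Delta :: "nat \<Rightarrow> nat \<Rightarrow> nat list set" where
  "Delta n k = {a. length a = k \<and> sum_list a = n}"

(* Lists are indexed from 0, so the entry a_i of the tuple is a ! (i - 1). *)
definition cell :: "nat \<Rightarrow> nat \<Rightarrow> nat list \<Rightarrow> nat list set" where
  "cell n k a = {w \<in> words n k. \<forall>i \<in> {1..k}. count_list w i = a ! (i - 1)}"

definition simplices :: "nat \<Rightarrow> nat \<Rightarrow> nat list set set" where
  "simplices n k =
     {(\<lambda>i. a[i := a ! i + r]) ` {..<k} |a r. 0 < r \<and> r \<le> n \<and> a \<in> Delta (n - r) k}"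

definition fujimura :: "nat \<Rightarrow> nat \<Rightarrow> nat list set \<Rightarrow> bool" where
  "fujimura n k S \<longleftrightarrow> S \<subseteq> Delta n k \<and> (\<forall>T \<in> simplices n k. \<not> T \<subseteq> S)"

(* For k > 0 the maximum is over a finite set that contains card {} = 0. *)
definition c_mu :: "nat \<Rightarrow> nat \<Rightarrow> nat" where
  "c_mu n k = Max {card S |S. fujimura n k S}"

definition counterexample_set :: "nat list set" where
  "counterexample_set =
     {[1, 1], [1, 2], [1, 3], [2, 1], [2, 3], [2, 4],
      [3, 2], [3, 3], [3, 4], [4, 1], [4, 2], [4, 4]}"

end

theory Submission
  imports Defs
begin

text \<open>
  The set \<open>A\<close> is the 4 by 4 grid with the words \<open>14, 22, 31, 43\<close> removed. These
  form a permutation matrix meeting the diagonal, so they hit all four rows, all four columns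
  and the diagonal, which are the nine combinatorial lines of \<open>[4]\<^sup>2\<close>; thus \<open>A\<close> is line-free.
  Each of the ten cells would contribute 1 to the sum for the full grid. The word \<open>22\<close> is a cell
  by itself, and the other three removed words are each half of a different two-word cell, so
  the sum for \<open>A\<close> is \<open>10 - 1 - 3/2 = 15/2\<close>.

  For \<open>c\<^sup>\<mu>\<^sub>2\<^sub>,\<^sub>4\<close> read a point of \<open>\<Delta>\<^sub>2\<^sub>,\<^sub>k\<close> as an edge \<open>e\<^sub>i + e\<^sub>j\<close> or a loop \<open>2 e\<^sub>i\<close> on \<open>k\<close> vertices.
  A simplex is then either the star of a vertex (with its loop) or the set of all loops. A set
  meeting all simplices therefore covers every vertex and contains a loop; as a loop covers one
  vertex and an edge two, a set of \<open>m\<close> points can do this only if \<open>k \<le> 2 m - 1\<close>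
  (lemma \<open>fujimura_2_complement\<close>). For \<open>k = 4\<close> at least three of the ten points are missing
  from a Fujimura set, and one loop with two edges suffices (\<open>fujimura_example\<close>).
  Thus \<open>c\<^sup>\<mu>\<^sub>2\<^sub>,\<^sub>4 = 7 < 15/2\<close>.
\<close>

section \<open>Enumerating compositions\<close>

lemma Delta_0: "Delta n 0 = (if n = 0 then {[]} else {})"
  by (auto simp: Delta_def)

lemma Delta_Suc: "Delta n (Suc k) = (\<Union>i\<in>{..n}. (#) i ` Delta (n - i) k)"
  by (auto simp: Delta_def length_Suc_conv image_iff)

lemma finite_Delta: "finite (Delta n k)"
  by (induction k arbitrary: n) (auto simp: Delta_0 Delta_Suc)

lemmas Delta_enum = Delta_0 Delta_Suc atMost_Suc numeral_eq_Suc

lemma Delta_2_4: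
  "Delta 2 4 = {[2,0,0,0], [0,2,0,0], [0,0,2,0], [0,0,0,2],
    [1,1,0,0], [1,0,1,0], [1,0,0,1], [0,1,1,0], [0,1,0,1], [0,0,1,1]}"
  by (simp add: Delta_enum insert_commute)

lemma Delta_1_4: "Delta 1 4 = {[1,0,0,0], [0,1,0,0], [0,0,1,0], [0,0,0,1]}"
  by (simp add: Delta_enum insert_commute)

lemma Delta_0_4: "Delta 0 4 = {[0,0,0,0]}"
  by (simp add: Delta_enum)

section \<open>Fujimura sets for n = 2\<close>

lemma card_support_le_sum_list:
  fixes a :: "nat list"
  shows "card {i. i < length a \<and> 0 < a ! i} \<le> sum_list a"
proof -
  have "card {i. i < length a \<and> 0 < a ! i} = (\<Sum>i | i < length a \<and> 0 < a ! i. 1)"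
    by simp
  also have "\<dots> \<le> (\<Sum>i | i < length a \<and> 0 < a ! i. a ! i)"
    by (rule sum_mono) auto
  also have "\<dots> \<le> (\<Sum>i = 0..<length a. a ! i)"
    by (rule sum_mono2) auto
  finally show ?thesis by (simp add: sum_list_sum_nth)
qed

lemma fujimura_simplex_miss:
  assumes "fujimura n k S" "0 < r" "r \<le> n" "a \<in> Delta (n - r) k"
  shows "\<exists>j<k. a[j := a ! j + r] \<in> Delta n k - S"
proof -
  have "(\<lambda>i. a[i := a ! i + r]) ` {..<k} \<in> simplices n k"
    using assms unfolding simplices_def by blast
  then have "\<not> (\<lambda>i. a[i := a ! i + r]) ` {..<k} \<subseteq> S"
    using assms(1) by (simp add: fujimura_def)
  then obtain j where j: "j < k" "a[j := a ! j + r] \<notin> S"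
    by blast
  moreover have "a[j := a ! j + r] \<in> Delta n k"
    using assms(3,4) j(1) elem_le_sum_list[of j a]
    by (simp add: Delta_def sum_list_update)
  ultimately show ?thesis by blast
qed

text \<open>Double counting of the pairs of a missing edge or loop and a vertex that it covers.\<close>

lemma fujimura_2_complement:
  assumes fuj: "fujimura 2 k S"
  shows "k + 1 \<le> 2 * card (Delta 2 k - S)"
proof -
  let ?T = "Delta 2 k - S"
  let ?supp = "\<lambda>a::nat list. {i. i < k \<and> 0 < a ! i}"
  have fin: "finite ?T" by (simp add: finite_Delta)
  have "replicate k 0 \<in> Delta (2 - 2) k" by (simp add: Delta_def)
  then have "\<exists>l<k. (replicate k 0)[l := replicate k 0 ! l + 2] \<in> ?T"
    by (intro fujimura_simplex_miss[OF fuj]) simp_all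
  then obtain l where l: "l < k" and lT: "(replicate k 0)[l := 2] \<in> ?T"
    by (metis add_0 nth_replicate)
  let ?loop = "(replicate k 0)[l := 2]"
  have supp_loop: "?supp ?loop = {l}"
    using l by (auto simp: nth_list_update split: if_splits)
  have cover: "{..<k} \<subseteq> (\<Union>a\<in>?T. ?supp a)"
  proof
    fix i assume "i \<in> {..<k}"
    then have i: "i < k" by simp
    let ?e = "(replicate k 0)[i := 1::nat]"
    have "?e \<in> Delta (2 - 1) k" using i by (simp add: Delta_def sum_list_update)
    then have "\<exists>j<k. ?e[j := ?e ! j + 1] \<in> ?T"
      by (intro fujimura_simplex_miss[OF fuj]) simp_all
    then obtain j where j: "j < k" "?e[j := ?e ! j + 1] \<in> ?T" by blast
    moreover have "0 < ?e[j := ?e ! j + 1] ! i"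
      using i by (simp add: nth_list_update)
    ultimately show "i \<in> (\<Union>a\<in>?T. ?supp a)" using i by blast
  qed
  have "k = card {..<k}" by simp
  also have "\<dots> \<le> card (\<Union>a\<in>?T. ?supp a)"
    by (rule card_mono[OF _ cover]) (auto simp: fin)
  also have "\<dots> \<le> (\<Sum>a\<in>?T. card (?supp a))"
    by (rule card_UN_le[OF fin])
  also have "\<dots> = 1 + (\<Sum>a\<in>?T - {?loop}. card (?supp a))"
    using sum.remove[OF fin lT, of "\<lambda>a. card (?supp a)"] supp_loop by simp
  also have "\<dots> \<le> 1 + (\<Sum>a\<in>?T - {?loop}. 2)"
  proof (intro add_left_mono sum_mono)
    fix a assume "a \<in> ?T - {?loop}"
    then show "card (?supp a) \<le> 2"
      using card_support_le_sum_list[of a] by (auto simp: Delta_def)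
  qed
  also have "\<dots> = 1 + 2 * (card ?T - 1)"
    using lT by (simp add: fin)
  finally have "k \<le> 1 + 2 * (card ?T - 1)" .
  moreover have "0 < card ?T" using lT fin by (auto simp: card_gt_0_iff)
  ultimately show ?thesis by linarith
qed

text \<open>
  The missing points are the loop at the first vertex and the two edges joining the second
  vertex to the third and to the fourth; together they cover all four vertices.
\<close>

lemma fujimura_example:
  "fujimura 2 4 (Delta 2 4 - {[2,0,0,0], [0,1,1,0], [0,1,0,1]})"
  unfolding fujimura_def
proof (intro conjI ballI notI)
  fix T assume "T \<in> simplices 2 4"
  then obtain a r :: "_" where T: "T = (\<lambda>i. a[i := a ! i + r]) ` {..<4::nat}"
    and r: "0 < r" "r \<le> 2" and a: "a \<in> Delta (2 - r) 4"
    unfolding simplices_def by blast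
  assume "T \<subseteq> Delta 2 4 - {[2,0,0,0], [0,1,1,0], [0,1,0,1]}"
  then have "\<forall>i\<in>{0,1,2,3}. a[i := a ! i + r] \<notin> {[2,0,0,0], [0,1,1,0], [0,1,0,1]}"
    unfolding T by (simp add: image_subset_iff)
  moreover have "r = 1 \<or> r = 2" using r by linarith
  ultimately show False
    using a by (auto simp: Delta_0_4 Delta_1_4[simplified])
qed auto

lemma c_mu_2_4: "c_mu 2 4 = 7"
  unfolding c_mu_def
proof (rule Max_eqI)
  have card10: "card (Delta 2 4) = 10" by (simp add: Delta_2_4)
  have "{card S |S. fujimura 2 4 S} \<subseteq> card ` Pow (Delta 2 4)"
    by (auto simp: fujimura_def)
  then show "finite {card S |S. fujimura 2 4 S}"
    by (rule finite_subset) (simp add: finite_Delta)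
  show "y \<le> 7" if y: "y \<in> {card S |S. fujimura 2 4 S}" for y
  proof -
    from y obtain S where S: "y = card S" "fujimura 2 4 S" by blast
    then have sub: "S \<subseteq> Delta 2 4" by (simp add: fujimura_def)
    have "card (Delta 2 4 - S) = 10 - card S"
      using card_Diff_subset[OF finite_subset[OF sub finite_Delta] sub] card10 by simp
    then show ?thesis using fujimura_2_complement[OF S(2)] S(1) by simp
  qed
  have "card (Delta 2 4 - {[2,0,0,0], [0,1,1,0], [0,1,0,1]}) = 7"
    by (subst card_Diff_subset) (simp_all add: card10, simp add: Delta_2_4)
  then show "7 \<in> {card S |S. fujimura 2 4 S}"
    using fujimura_example by force
qed

section \<open>The counterexample\<close>

lemma counterexample_subset: "counterexample_set \<subseteq> words 2 4"
  by (auto simp: counterexample_set_def words_def)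

lemma line_free_counterexample: "line_free 2 4 counterexample_set"
  unfolding line_free_def
proof (intro ballI notI)
  fix L assume "L \<in> combinatorial_lines 2 4" and sub: "L \<subseteq> counterexample_set"
  then obtain w where w: "w \<in> line_templates 2 4" and L: "L = subst_wild w ` {1..4}"
    unfolding combinatorial_lines_def by blast
  have range4: "{1..4::nat} = {1,2,3,4}" by auto
  from w have "length w = Suc (Suc 0)"
    and alphabet: "set w \<subseteq> insert None (Some ` {1,2,3,4})" "None \<in> set w"
    unfolding line_templates_def range4 by simp_all
  then obtain p q where "w = [p, q]"
    unfolding length_Suc_conv by blast
  with alphabet have pq: "w = [p, q]" "p \<in> insert None (Some ` {1,2,3,4})"
      "q \<in> insert None (Some ` {1,2,3,4})" "p = None \<or> q = None"
    by auto
  have line: "\<forall>i\<in>{1,2,3,4}. subst_wild w i \<in> counterexample_set"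
    using sub unfolding L range4 by blast
  have "p \<in> {None, Some 1, Some 2, Some 3, Some 4}" "q \<in> {None, Some 1, Some 2, Some 3, Some 4}"
    using pq(2,3) by simp_all
  with pq(4) consider "w = [None, None]"
    | c where "c \<in> {1,2,3,4}" "w = [None, Some c]"
    | c where "c \<in> {1,2,3,4}" "w = [Some c, None]"
    using pq(1) by blast
  \<comment> \<open>Each case exhibits the removed word on the line: on the diagonal, on column \<open>c\<close>, on row \<open>c\<close>.\<close>
  then show False
  proof cases
    case 1
    have "[2, 2] \<in> counterexample_set"
      using line by (simp add: 1 subst_wild_def)
    then show False by (simp add: counterexample_set_def)
  next
    case 2
    have "\<forall>i\<in>{1,2,3,4}. [i, c] \<in> counterexample_set"
      using line by (simp add: 2(2) subst_wild_def)
    then have "[3, 1] \<in> counterexample_set \<or> c \<noteq> 1" "[2, 2] \<in> counterexample_set \<or> c \<noteq> 2"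
      "[4, 3] \<in> counterexample_set \<or> c \<noteq> 3" "[1, 4] \<in> counterexample_set \<or> c \<noteq> 4"
      by blast+
    then show False using 2(1) by (simp add: counterexample_set_def)
  next
    case 3
    have "\<forall>i\<in>{1,2,3,4}. [c, i] \<in> counterexample_set"
      using line by (simp add: 3(2) subst_wild_def)
    then have "[1, 4] \<in> counterexample_set \<or> c \<noteq> 1" "[2, 2] \<in> counterexample_set \<or> c \<noteq> 2"
      "[3, 1] \<in> counterexample_set \<or> c \<noteq> 3" "[4, 3] \<in> counterexample_set \<or> c \<noteq> 4"
      by blast+
    then show False using 3(1) by (simp add: counterexample_set_def)
  qed
qed

lemma words_eq_n_lists: "words n k = set (List.n_lists n [1..<Suc k])"
  by (auto simp: words_def set_n_lists)

text \<open>Cells as filtered lists, so that cardinalities become lengths.\<close>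

lemma card_Int_cell:
  assumes "distinct xs" "set xs \<subseteq> words n k"
  shows "card (set xs \<inter> cell n k a) =
    length (filter (\<lambda>w. \<forall>i\<in>{1..k}. count_list w i = a ! (i - 1)) xs)"
proof -
  have "set xs \<inter> cell n k a = set (filter (\<lambda>w. \<forall>i\<in>{1..k}. count_list w i = a ! (i - 1)) xs)"
    using assms(2) by (auto simp: cell_def)
  then show ?thesis using distinct_card[OF distinct_filter[OF assms(1)]] by simp
qed

lemma counterexample_sum:
  "(\<Sum>a \<in> Delta 2 4. real (card (counterexample_set \<inter> cell 2 4 a)) / real (card (cell 2 4 a)))
    = 15 / 2"
proof -
  have range4: "{1..4::nat} = {1,2,3,4}" by auto
  let ?xs = "[[1, 1], [1, 2], [1, 3], [2, 1], [2, 3], [2, 4],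
      [3, 2], [3, 3], [3, 4], [4, 1], [4, 2], [4, 4]] :: nat list list"
  have A: "counterexample_set = set ?xs" by (simp add: counterexample_set_def)
  have num: "card (counterexample_set \<inter> cell 2 4 a) =
      length (filter (\<lambda>w. \<forall>i\<in>{1..4}. count_list w i = a ! (i - 1)) ?xs)" for a
    unfolding A by (rule card_Int_cell) (use counterexample_subset A in auto)
  let ?ys = "List.n_lists 2 [1..<Suc 4]"
  have "set ?ys \<inter> cell 2 4 a = cell 2 4 a" for a
    by (auto simp: cell_def words_eq_n_lists)
  then have den: "card (cell 2 4 a) =
      length (filter (\<lambda>w. \<forall>i\<in>{1..4}. count_list w i = a ! (i - 1)) ?ys)" for a
    using card_Int_cell[of ?ys 2 4 a] by (simp add: distinct_n_lists words_eq_n_lists)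
  have ys: "?ys = [[1,1],[2,1],[3,1],[4,1],[1,2],[2,2],[3,2],[4,2],
      [1,3],[2,3],[3,3],[4,3],[1,4],[2,4],[3,4],[4,4]]"
    by code_simp
  show ?thesis unfolding num den ys Delta_2_4 range4 by simp
qed

theorem mainTheorem4:
  shows "counterexample_set \<subseteq> words 2 4
    \<and> line_free 2 4 counterexample_set
    \<and> c_mu 2 4 = 7
    \<and> (\<Sum>a \<in> Delta 2 4. real (card (counterexample_set \<inter> cell 2 4 a)) / real (card (cell 2 4 a)))
        > real (c_mu 2 4)
    \<and> \<not> (\<forall>A. A \<subseteq> words 2 4 \<and> line_free 2 4 A \<longrightarrow>
          (\<Sum>a \<in> Delta 2 4. real (card (A \<inter> cell 2 4 a)) / real (card (cell 2 4 a)))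
            \<le> real (c_mu 2 4))"
proof -
  have gt: "(\<Sum>a \<in> Delta 2 4. real (card (counterexample_set \<inter> cell 2 4 a))
      / real (card (cell 2 4 a))) > real (c_mu 2 4)"
    unfolding counterexample_sum c_mu_2_4 by simp
  then show ?thesis
    using counterexample_subset line_free_counterexample c_mu_2_4 by (meson not_le)
qed

end
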